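(* Let $D$ be an integrally closed domain which is not a field, with quotient field $K$. Let $\Omega\subset D$ be a finite set and let $n\geq 0$ be an integer. Then the integral closure of $\mathrm{Int}^{\{n\}}(\Omega,D)$ (in its quotient field $K(X)$) is $\mathrm{Int}(\Omega,D)$.
   Context: For $f\in K[X]$ the divided differences are defined recursively by $\Phi^0(f)(X_0)=f(X_0)$ and, for $k\ge 1$, $$\Phi^k(f)(X_0,\ldots,X_k)=\frac{\Phi^{k-1}(f)(X_0,\ldots,X_{k-1})-\Phi^{k-1}(f)(X_0,\ldots,X_{k-2},X_k)}{X_{k-1}-X_k};$$ $\Phi^k(f)$ is a symmetric polynomial over $K$ in $k+1$ variables. Define $$\mathrm{Int}^{\{n\}}(\Omega,D)=\{f\in K[X] : \Phi^k(f)(\Omega^{k+1})\subset D\text{ for all }0\le k\le n\}$$ and $\mathrm{Int}(\Omega,D)=\{f\in K[X] : f(\Omega)\subset D\}$. *)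

theory Defs
  imports "HOL-Computational_Algebra.Computational_Algebra" "HOL-Library.Poly_Mapping"
begin

text \<open>
  A domain \<open>D\<close> is a type \<open>'a\<close> of class \<^class>\<open>idom\<close> and its quotient field \<open>K\<close> is
  \<^typ>\<open>'a fract\<close>, into which \<open>D\<close> embeds by \<^const>\<open>to_fract\<close>.  Thus \<open>K[X]\<close> is
  \<^typ>\<open>'a fract poly\<close> and \<open>K(X)\<close> is \<^typ>\<open>'a fract poly fract\<close>.
\<close>

section \<open>Integral closure\<close>

text \<open>In this section a domain is given as a subring \<open>R\<close> of a field.\<close>

definition quotient_field :: "'k::field set \<Rightarrow> 'k set" where
  "quotient_field R = {a / b |a b. a \<in> R \<and> b \<in> R \<and> b \<noteq> 0}"

definition integral_over :: "'k::field set \<Rightarrow> 'k \<Rightarrow> bool" where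
  "integral_over R z \<longleftrightarrow>
     (\<exists>p. lead_coeff p = 1 \<and> (\<forall>i. coeff p i \<in> R) \<and> poly p z = 0)"

definition integral_closure :: "'k::field set \<Rightarrow> 'k set" where
  "integral_closure R = {z \<in> quotient_field R. integral_over R z}"

definition integrally_closed :: "'k::field set \<Rightarrow> bool" where
  "integrally_closed R \<longleftrightarrow> integral_closure R = R"

section \<open>Divided differences\<close>

text \<open>
  Polynomials over \<open>'k\<close> in the variables \<open>X\<^sub>0, X\<^sub>1, \<dots>\<close>: finitely supported maps from
  exponent vectors to coefficients, with the convolution product of \<open>Poly_Mapping\<close>.
\<close>

type_synonym 'k multi_poly = "(nat \<Rightarrow>\<^sub>0 nat) \<Rightarrow>\<^sub>0 'k"

definition multi_const :: "'k::zero \<Rightarrow> 'k multi_poly" where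
  "multi_const c = Poly_Mapping.single 0 c"

definition multi_var :: "nat \<Rightarrow> 'k::zero_neq_one multi_poly" where
  "multi_var i = Poly_Mapping.single (Poly_Mapping.single i 1) 1"

definition multi_eval :: "'k::comm_semiring_1 multi_poly \<Rightarrow> (nat \<Rightarrow> 'k) \<Rightarrow> 'k" where
  "multi_eval P x =
     (\<Sum>m\<in>Poly_Mapping.keys P. Poly_Mapping.lookup P m *
        (\<Prod>i\<in>Poly_Mapping.keys m. x i ^ Poly_Mapping.lookup m i))"

text \<open>
  The defining recursion, for a function \<open>F\<close> on a field \<open>L\<close> and \<open>k + 1\<close> arguments
  \<open>x 0, \<dots>, x k\<close> in \<open>L\<close>.  It is meaningful for pairwise distinct arguments only, and below it
  is used only with \<open>L = K(X\<^sub>0, X\<^sub>1, \<dots>)\<close> and \<open>x i = X\<^sub>i\<close>.  The values of \<open>\<Phi>\<^sup>k(f)\<close> at points with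
  repeated coordinates are those of the polynomial \<open>\<Phi>\<^sup>k(f)\<close>.
\<close>

primrec div_diff_rec :: "('l::field \<Rightarrow> 'l) \<Rightarrow> nat \<Rightarrow> (nat \<Rightarrow> 'l) \<Rightarrow> 'l" where
  "div_diff_rec F 0 x = F (x 0)"
| "div_diff_rec F (Suc k) x =
     (div_diff_rec F k x - div_diff_rec F k (x(k := x (Suc k)))) / (x k - x (Suc k))"

definition generic_div_diff :: "nat \<Rightarrow> 'k::field poly \<Rightarrow> 'k multi_poly fract" where
  "generic_div_diff k f =
     div_diff_rec (\<lambda>z. poly (map_poly (\<lambda>c. to_fract (multi_const c)) f) z) k
       (\<lambda>i. to_fract (multi_var i))"

definition div_diff :: "nat \<Rightarrow> 'k::field poly \<Rightarrow> 'k multi_poly" where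
  "div_diff k f = (THE P. to_fract P = generic_div_diff k f)"

text \<open>The description in \<open>div_diff\<close> determines a polynomial.\<close>

lemma div_diff_rec_cong:
  "(\<And>i. i \<le> k \<Longrightarrow> x i = y i) \<Longrightarrow> div_diff_rec F k x = div_diff_rec F k y"
proof (induction k arbitrary: x y)
  case (Suc k)
  have "div_diff_rec F k x = div_diff_rec F k y"
    using Suc.prems by (intro Suc.IH) auto
  moreover have "div_diff_rec F k (x(k := x (Suc k))) = div_diff_rec F k (y(k := y (Suc k)))"
    using Suc.prems by (intro Suc.IH) auto
  ultimately show ?case using Suc.prems by simp
qed simp

lemma div_diff_rec_const_plus:
  "div_diff_rec (\<lambda>z. c + F z) k x = (if k = 0 then c else 0) + div_diff_rec F k x"
  by (induction k arbitrary: x) (auto simp: field_simps)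

lemma div_diff_rec_times:
  assumes "inj_on x {..Suc k}"
  shows "div_diff_rec (\<lambda>z. z * F z) (Suc k) x =
           x (Suc k) * div_diff_rec F (Suc k) x + div_diff_rec F k x"
  using assms
proof (induction k arbitrary: x)
  case 0
  then have "x 0 \<noteq> x 1" by (auto simp: inj_on_def)
  then show ?case by (simp add: field_simps)
next
  case (Suc k)
  define y where "y = x(Suc k := x (Suc (Suc k)))"
  have ne: "x (Suc k) - x (Suc (Suc k)) \<noteq> 0"
    using inj_onD[OF Suc.prems, of "Suc k" "Suc (Suc k)"] by auto
  have "inj_on x {..Suc k}"
    using Suc.prems by (rule inj_on_subset) auto
  then have 1: "div_diff_rec (\<lambda>z. z * F z) (Suc k) x =
      x (Suc k) * div_diff_rec F (Suc k) x + div_diff_rec F k x"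
    by (rule Suc.IH)
  have "inj_on y {..Suc k}"
  proof (rule inj_onI)
    fix i j assume ij: "i \<in> {..Suc k}" "j \<in> {..Suc k}" and eq: "y i = y j"
    let ?s = "\<lambda>i. if i = Suc k then Suc (Suc k) else i"
    have "x (?s i) = x (?s j)" using eq by (simp add: y_def split: if_splits)
    then have "?s i = ?s j" using ij by (intro inj_onD[OF Suc.prems]) auto
    then show "i = j" using ij by (simp split: if_splits)
  qed
  then have 2: "div_diff_rec (\<lambda>z. z * F z) (Suc k) y =
      y (Suc k) * div_diff_rec F (Suc k) y + div_diff_rec F k y"
    by (rule Suc.IH)
  have 3: "div_diff_rec F k y = div_diff_rec F k x"
    by (rule div_diff_rec_cong) (auto simp: y_def)
  have 4: "y (Suc k) = x (Suc (Suc k))" by (simp add: y_def)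
  have rec: "div_diff_rec G (Suc (Suc k)) x =
      (div_diff_rec G (Suc k) x - div_diff_rec G (Suc k) y) / (x (Suc k) - x (Suc (Suc k)))" for G
    by (simp add: y_def del: div_diff_rec.simps(2)) (simp only: div_diff_rec.simps(2))
  show ?case unfolding rec 1 2 3 4 using ne by (simp add: field_simps del: div_diff_rec.simps)
qed

lemma inj_multi_var: "inj (multi_var :: nat \<Rightarrow> 'k::zero_neq_one multi_poly)"
  unfolding multi_var_def
  by (rule injI) (metis keys_single singleton_inject one_neq_zero)

lemma ex1_div_diff: "\<exists>!P. to_fract P = generic_div_diff k (f :: 'k::field poly)"
proof -
  let ?x = "\<lambda>i. to_fract (multi_var i :: 'k multi_poly)"
  have "\<exists>P. to_fract P = generic_div_diff k f"
  proof (induction f arbitrary: k)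
    case 0
    have "div_diff_rec (\<lambda>_. 0) k x = (0 :: 'k multi_poly fract)" for x
      by (induction k arbitrary: x) auto
    then show ?case
      by (intro exI[of _ 0]) (simp add: generic_div_diff_def)
  next
    case (pCons a f)
    let ?F = "\<lambda>z. poly (map_poly (\<lambda>c. to_fract (multi_const c)) f) z"
    have const0: "to_fract (multi_const (0 :: 'k)) = 0"
      by (simp add: multi_const_def)
    have eq: "generic_div_diff k (pCons a f) =
        (if k = 0 then to_fract (multi_const a) else 0) + div_diff_rec (\<lambda>z. z * ?F z) k ?x"
      using pCons.hyps const0
      by (simp add: generic_div_diff_def map_poly_pCons div_diff_rec_const_plus)
    obtain P where P: "\<And>k. to_fract (P k) = generic_div_diff k f"
      using pCons.IH by metis
    show ?case
    proof (cases k)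
      case 0
      have "generic_div_diff k (pCons a f) = to_fract (multi_const a + multi_var 0 * P 0)"
        using eq 0 P[of 0] by (simp add: generic_div_diff_def)
      then show ?thesis by metis
    next
      case (Suc l)
      have "inj_on ?x {..Suc l}"
        using inj_multi_var[where 'k = 'k] by (auto simp: inj_on_def)
      then have "generic_div_diff k (pCons a f) = to_fract (multi_var (Suc l) * P (Suc l) + P l)"
        using eq Suc P[of "Suc l"] P[of l]
        by (simp add: generic_div_diff_def div_diff_rec_times del: div_diff_rec.simps)
      then show ?thesis by metis
    qed
  qed
  then show ?thesis by (metis to_fract_eq_iff)
qed

section \<open>Rings of integer-valued polynomials\<close>

definition Int_poly :: "'a::idom set \<Rightarrow> 'a fract poly set" where
  "Int_poly \<Omega> = {f. \<forall>a\<in>\<Omega>. poly f (to_fract a) \<in> range to_fract}"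

text \<open>
  A point of \<open>\<Omega>\<^sup>k\<^sup>+\<^sup>1\<close> is a sequence with entries \<open>0, \<dots>, k\<close> in \<open>\<Omega>\<close>; the remaining entries do not
  matter, as \<open>\<Phi>\<^sup>k(f)\<close> involves only the variables \<open>X\<^sub>0, \<dots>, X\<^sub>k\<close>.
\<close>

definition Int_div_diff :: "nat \<Rightarrow> 'a::idom set \<Rightarrow> 'a fract poly set" where
  "Int_div_diff n \<Omega> =
     {f. \<forall>k\<le>n. \<forall>x. (\<forall>i\<le>k. x i \<in> \<Omega>) \<longrightarrow>
           multi_eval (div_diff k f) (\<lambda>i. to_fract (x i)) \<in> range to_fract}"

end

theory Submission
  imports Defs
begin

text \<open>
  Write \<open>R\<close> for the ring of those \<open>f\<close> whose divided differences up to order \<open>n\<close> take values in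
  \<open>D\<close> on \<open>\<Omega>\<close>.  It contains \<open>D[X]\<close>, because divided differences of a polynomial over \<open>D\<close> have
  coefficients in \<open>D\<close>; clearing denominators then shows that its quotient field is \<open>K(X)\<close>.

  An element of \<open>K(X)\<close> that is integral over \<open>R\<close> is integral over \<open>K[X]\<close>, hence a polynomial \<open>f\<close>,
  since the Euclidean ring \<open>K[X]\<close> is integrally closed (\<open>euclidean_ring_integrally_closed\<close>).
  Evaluating an integral equation of \<open>f\<close> at \<open>a \<in> \<Omega>\<close> gives an integral equation of \<open>f(a)\<close> over \<open>D\<close>,
  as the elements of \<open>R\<close> are integer-valued on \<open>\<Omega>\<close>; so \<open>f(a) \<in> D\<close>, as \<open>D\<close> is integrally closed
  (\<open>integral_over_Int_div_diff_imp\<close>).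

  Conversely, let \<open>f(\<Omega>) \<subseteq> D\<close>.  As \<open>\<Omega>\<close> is finite, there is a monic polynomial \<open>h\<close> over \<open>D\<close> that
  has every \<open>f(a)\<close>, \<open>a \<in> \<Omega>\<close>, as a root.  Then \<open>h(f)\<close> vanishes on \<open>\<Omega>\<close>, so \<open>h(f)\<^sup>n\<^sup>+\<^sup>1\<close> vanishes
  there to order \<open>n + 1\<close>.  A divided difference of order \<open>k \<le> n\<close> at points of \<open>\<Omega>\<close>, coincident or
  not, is \<open>0\<close> on such a polynomial (\<open>div_diff_at_eq_0\<close>).  Hence \<open>F = h(f)\<^sup>n\<^sup>+\<^sup>1\<close> lies in \<open>R\<close>, and
  \<open>h\<^sup>n\<^sup>+\<^sup>1 - F\<close> is a monic polynomial over \<open>R\<close> with root \<open>f\<close>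
  (\<open>Int_poly_integral_over_Int_div_diff\<close>).

  All values of divided differences are computed from one recursion on the coefficients of the
  polynomial (\<open>div_diff_at_pCons\<close>), which involves no division and so is valid at
  coincident points too.
\<close>

section \<open>Integral elements\<close>

text \<open>
  With an explicit list of coefficients an integral equation can be pushed through ring
  homomorphisms without keeping track of degrees of polynomials over fraction fields.
\<close>

lemma integral_over_iff:
  assumes "0 \<in> R" "1 \<in> R"
  shows "integral_over R z \<longleftrightarrow>
           (\<exists>m c. (\<forall>i<m. c i \<in> R) \<and> z ^ m + (\<Sum>i<m. c i * z ^ i) = 0)"
proof
  assume "integral_over R z"
  then obtain p where p: "lead_coeff p = 1" "\<And>i. coeff p i \<in> R" "poly p z = 0"
    by (auto simp: integral_over_def)
  have "z ^ degree p + (\<Sum>i<degree p. coeff p i * z ^ i) = 0"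
    using p by (simp add: poly_altdef add.commute flip: lessThan_Suc_atMost)
  with p show "\<exists>m c. (\<forall>i<m. c i \<in> R) \<and> z ^ m + (\<Sum>i<m. c i * z ^ i) = 0"
    by blast
next
  assume "\<exists>m c. (\<forall>i<m. c i \<in> R) \<and> z ^ m + (\<Sum>i<m. c i * z ^ i) = 0"
  then obtain m c where c: "\<And>i. i < m \<Longrightarrow> c i \<in> R" and rel: "z ^ m + (\<Sum>i<m. c i * z ^ i) = 0"
    by blast
  define p where "p = monom 1 m + (\<Sum>i<m. monom (c i) i)"
  have coeff: "coeff p i = (if i = m then 1 else if i < m then c i else 0)" for i
    by (auto simp: p_def coeff_sum sum.delta)
  have "degree p \<le> m" by (rule degree_le) (simp add: coeff)
  moreover have "m \<le> degree p" by (rule le_degree) (simp add: coeff)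
  ultimately have "lead_coeff p = 1" by (simp add: coeff)
  moreover have "coeff p i \<in> R" for i using c assms by (simp add: coeff)
  moreover have "poly p z = 0" using rel by (simp add: p_def poly_sum poly_monom)
  ultimately show "integral_over R z" by (auto simp: integral_over_def)
qed

lemma integral_over_mono: "integral_over R z \<Longrightarrow> R \<subseteq> S \<Longrightarrow> integral_over S z"
  unfolding integral_over_def by blast

lemma to_fract_power: "to_fract (x ^ n) = to_fract x ^ n"
  by (induction n) auto

lemma zero_one_in_range_to_fract: "0 \<in> range to_fract" "1 \<in> range to_fract"
  by (metis rangeI to_fract_0, metis rangeI to_fract_1)

lemma fract_eq_divide:
  obtains a b where "b \<noteq> 0" "z = to_fract a / to_fract b"
  by (cases z) (simp add: Fract_conv_to_fract)

text \<open>
  The common denominators of all powers of an integral element \<open>z\<close> form a nonzero ideal that is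
  mapped into itself by multiplication with \<open>z\<close>.  In a Euclidean ring it has a generator \<open>h\<close>;
  then \<open>z h\<close> is a multiple \<open>q h\<close>, and \<open>z = q\<close>.
\<close>

lemma euclidean_ring_integrally_closed:
  fixes z :: "'b::euclidean_ring fract"
  assumes "integral_over (range to_fract) z"
  shows "z \<in> range to_fract"
proof -
  let ?D = "range (to_fract :: 'b \<Rightarrow> 'b fract)"
  have D_add: "x + y \<in> ?D" if "x \<in> ?D" "y \<in> ?D" for x y
    using that by (auto simp flip: to_fract_add)
  have D_uminus: "- x \<in> ?D" if "x \<in> ?D" for x
    using that by (auto simp flip: to_fract_uminus)
  have D_mult: "x * y \<in> ?D" if "x \<in> ?D" "y \<in> ?D" for x y
    using that by (auto simp flip: to_fract_mult)
  have D_sum: "sum g A \<in> ?D" if "\<And>i. i \<in> A \<Longrightarrow> g i \<in> ?D" for g and A :: "nat set"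
    using that
  proof (induction A rule: infinite_finite_induct)
    case (insert i A)
    then show ?case by (auto intro!: D_add)
  qed (auto simp flip: to_fract_0)
  obtain m c where c: "\<And>i. i < m \<Longrightarrow> c i \<in> ?D" and rel: "z ^ m + (\<Sum>i<m. c i * z ^ i) = 0"
    using assms by (auto simp: integral_over_iff zero_one_in_range_to_fract)
  obtain u v where uv: "v \<noteq> 0" "z = to_fract u / to_fract v"
    by (rule fract_eq_divide)
  define A where "A = {h. h \<noteq> 0 \<and> (\<forall>i. to_fract h * z ^ i \<in> ?D)}"
  \<comment> \<open>Powers up to \<open>m\<close> have \<open>v\<^sup>m\<close> as a denominator; the integral equation reduces the others to them.\<close>
  have "to_fract (v ^ m) * z ^ i \<in> ?D" for i
  proof (induction i rule: less_induct)
    case (less i)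
    show ?case
    proof (cases "i \<le> m")
      case True
      then have "v ^ m = v ^ (m - i) * v ^ i" by (simp flip: power_add)
      then have "to_fract (v ^ m) * z ^ i = to_fract (v ^ (m - i) * u ^ i)"
        using uv by (simp add: to_fract_power power_divide)
      then show ?thesis by (simp only: rangeI)
    next
      case False
      then have "z ^ i = z ^ (i - m) * z ^ m" by (simp flip: power_add)
      also have "z ^ m = - (\<Sum>j<m. c j * z ^ j)" using rel by (simp add: eq_neg_iff_add_eq_0)
      finally have "to_fract (v ^ m) * z ^ i =
          - (\<Sum>j<m. c j * (to_fract (v ^ m) * z ^ (i - m + j)))"
        by (simp add: sum_distrib_left sum_negf mult_ac power_add)
      also have "\<dots> \<in> ?D"
      proof (intro D_uminus D_sum)
        fix j assume "j \<in> {..<m}"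
        then have "to_fract (v ^ m) * z ^ (i - m + j) \<in> ?D" "c j \<in> ?D"
          using False c by (auto intro!: less.IH simp del: to_fract_mult)
        then show "c j * (to_fract (v ^ m) * z ^ (i - m + j)) \<in> ?D" by (rule D_mult[rotated])
      qed
      finally show ?thesis .
    qed
  qed
  then have "v ^ m \<in> A" using uv by (simp add: A_def)
  define h where "h = arg_min euclidean_size (\<lambda>h. h \<in> A)"
  have h: "h \<in> A" and h_min: "\<And>w. w \<in> A \<Longrightarrow> euclidean_size h \<le> euclidean_size w"
    using arg_min_natI[of "\<lambda>h. h \<in> A"] arg_min_nat_le[of "\<lambda>h. h \<in> A"] \<open>v ^ m \<in> A\<close>
    unfolding h_def by blast+
  have "to_fract h * z ^ 1 \<in> ?D" using h unfolding A_def by blast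
  then obtain w where w: "to_fract h * z = to_fract w" by auto
  \<comment> \<open>The remainder \<open>r\<close> satisfies the conditions on a common denominator, so it is \<open>0\<close> by minimality of \<open>h\<close>.\<close>
  define r where "r = w mod h"
  have r: "r = w + (- (w div h)) * h" by (simp add: r_def minus_div_mult_eq_mod)
  have "to_fract r * z ^ i \<in> ?D" for i
  proof -
    have "to_fract r * z ^ i =
        to_fract h * z ^ Suc i + to_fract (- (w div h)) * (to_fract h * z ^ i)"
      unfolding r by (simp add: algebra_simps flip: w)
    also have "\<dots> \<in> ?D" using h unfolding A_def by (blast intro: D_add D_mult)
    finally show ?thesis .
  qed
  moreover have "euclidean_size r < euclidean_size h"
    using h by (auto simp: A_def r_def mod_size_less)
  ultimately have "r = 0" using h_min[of r] by (force simp: A_def)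
  then have "w = (w div h) * h" using r by simp
  then have "to_fract h * z = to_fract h * to_fract (w div h)"
    using w by (metis to_fract_mult mult.commute)
  then show ?thesis using h by (auto simp: A_def)
qed

section \<open>Values of divided differences\<close>

lemma multi_eval_add: "multi_eval (P + Q) x = multi_eval P x + multi_eval Q x"
  unfolding multi_eval_def
  by (rule setsum_keys_plus_distrib
      [where f = "\<lambda>m c. c * (\<Prod>i\<in>Poly_Mapping.keys m. x i ^ Poly_Mapping.lookup m i)"])
     (simp_all add: distrib_right)

lemma multi_eval_single:
  "multi_eval (Poly_Mapping.single m c) x =
     c * (\<Prod>i\<in>Poly_Mapping.keys m. x i ^ Poly_Mapping.lookup m i)"
  by (simp add: multi_eval_def)

text \<open>
  Multiplicativity for a monomial factor is enough: the recursion for divided differences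
  multiplies by variables only.
\<close>

lemma multi_eval_single_mult:
  "multi_eval (Poly_Mapping.single m c * P) x = multi_eval (Poly_Mapping.single m c) x * multi_eval P x"
proof (induction P rule: update_induct)
  case const
  show ?case by (simp add: multi_eval_def)
next
  case (update P k b)
  let ?mon = "\<lambda>m. \<Prod>i\<in>Poly_Mapping.keys m. x i ^ Poly_Mapping.lookup m i"
  \<comment> \<open>All three monomials as products over one index set, so that exponents can be added factorwise.\<close>
  have supp: "?mon l = (\<Prod>i\<in>Poly_Mapping.keys m \<union> Poly_Mapping.keys k. x i ^ Poly_Mapping.lookup l i)"
    if "Poly_Mapping.keys l \<subseteq> Poly_Mapping.keys m \<union> Poly_Mapping.keys k" for l
    by (rule prod.mono_neutral_left) (use that in \<open>auto simp: in_keys_iff\<close>)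
  have mon: "?mon (m + k) = ?mon m * ?mon k"
    unfolding supp[OF keys_add] supp[OF Un_upper1] supp[OF Un_upper2]
    by (simp add: lookup_add power_add prod.distrib)
  have "Poly_Mapping.update k b P = P + Poly_Mapping.single k b"
    using update.hyps
    by (intro poly_mapping_eqI)
       (auto simp: lookup_update lookup_add lookup_single in_keys_iff when_def)
  then show ?case
    using update.IH
    by (simp add: multi_eval_add multi_eval_single mult_single distrib_left mon) (simp add: mult_ac)
qed

abbreviation div_diff_at :: "nat \<Rightarrow> 'k::field poly \<Rightarrow> (nat \<Rightarrow> 'k) \<Rightarrow> 'k" where
  "div_diff_at k f x \<equiv> multi_eval (div_diff k f) x"

lemma to_fract_div_diff: "to_fract (div_diff k f) = generic_div_diff k f"
  unfolding div_diff_def by (rule theI'[OF ex1_div_diff])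

lemma div_diff_0: "div_diff k 0 = 0"
proof -
  have "div_diff_rec (\<lambda>_. 0) k x = (0 :: 'k multi_poly fract)" for x :: "nat \<Rightarrow> 'k::field multi_poly fract"
    by (induction k arbitrary: x) auto
  then have "generic_div_diff k 0 = 0" by (simp add: generic_div_diff_def)
  then show ?thesis by (metis to_fract_div_diff to_fract_eq_0_iff)
qed

lemma generic_div_diff_pCons:
  fixes a :: "'k::field"
  shows "generic_div_diff k (pCons a f) =
     (if k = 0 then to_fract (multi_const a) else 0) +
     div_diff_rec (\<lambda>z. z * poly (map_poly (\<lambda>c. to_fract (multi_const c)) f) z) k
       (\<lambda>i. to_fract (multi_var i))"
proof -
  have "to_fract (multi_const (0 :: 'k)) = 0" by (simp add: multi_const_def)
  then have "map_poly (\<lambda>c. to_fract (multi_const c)) (pCons a f) =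
      pCons (to_fract (multi_const a)) (map_poly (\<lambda>c. to_fract (multi_const c)) f)"
    by (intro poly_eqI) (simp add: coeff_map_poly coeff_pCons split: nat.split)
  then show ?thesis by (simp add: generic_div_diff_def div_diff_rec_const_plus)
qed

lemma div_diff_pCons_0: "div_diff 0 (pCons a f) = multi_const a + multi_var 0 * div_diff 0 f"
proof -
  have "to_fract (div_diff 0 (pCons a f)) = to_fract (multi_const a + multi_var 0 * div_diff 0 f)"
    by (simp add: to_fract_div_diff generic_div_diff_pCons) (simp add: generic_div_diff_def)
  then show ?thesis by (simp only: to_fract_eq_iff)
qed

lemma div_diff_pCons_Suc:
  "div_diff (Suc k) (pCons a f) = multi_var (Suc k) * div_diff (Suc k) f + div_diff k f"
proof -
  have "inj_on (\<lambda>i. to_fract (multi_var i :: 'a multi_poly)) {..Suc k}"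
    using inj_multi_var[where 'k = 'a] by (auto simp: inj_on_def)
  then have "to_fract (div_diff (Suc k) (pCons a f)) =
      to_fract (multi_var (Suc k) * div_diff (Suc k) f + div_diff k f)"
    by (simp add: to_fract_div_diff generic_div_diff_pCons div_diff_rec_times
        del: div_diff_rec.simps)
       (simp add: generic_div_diff_def del: div_diff_rec.simps)
  then show ?thesis by (simp only: to_fract_eq_iff)
qed

text \<open>
  This is the Leibniz rule for multiplication by \<open>X\<close>: the divided differences of \<open>X\<close> are the
  point itself in order \<open>0\<close>, the constant \<open>1\<close> in order \<open>1\<close>, and \<open>0\<close> above.  It determines all
  values of divided differences, also where the points coincide.
\<close>

lemma div_diff_at_pCons:
  "div_diff_at k (pCons a f) x =
     x k * div_diff_at k f x + (case k of 0 \<Rightarrow> a | Suc l \<Rightarrow> div_diff_at l f x)"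
  by (cases k)
     (simp_all add: div_diff_pCons_0 div_diff_pCons_Suc multi_eval_add multi_const_def multi_var_def
        multi_eval_single_mult multi_eval_single)

lemma div_diff_at_zero: "div_diff_at k 0 x = 0"
  by (simp add: div_diff_0 multi_eval_def)

lemma div_diff_at_diff: "div_diff_at k (f - g) x = div_diff_at k f x - div_diff_at k g x"
proof (induction f g arbitrary: k rule: poly_induct2)
  case (pCons a f b g)
  show ?case
    unfolding diff_pCons div_diff_at_pCons pCons.IH by (cases k) (simp_all add: algebra_simps)
qed (simp add: div_diff_at_zero)

lemma div_diff_at_smult: "div_diff_at k (smult c f) x = c * div_diff_at k f x"
  by (induction f arbitrary: k)
     (auto simp: div_diff_at_zero div_diff_at_pCons algebra_simps split: nat.split)

lemma div_diff_at_0: "div_diff_at 0 f x = poly f (x 0)"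
  by (induction f) (simp_all add: div_diff_at_zero div_diff_at_pCons)

text \<open>The Leibniz rule for \<open>X - a\<close>, where \<open>a\<close> is the last point: the leading term drops out.\<close>

lemma div_diff_at_linear_mult:
  "div_diff_at (Suc k) ([:- x (Suc k), 1:] * f) x = div_diff_at k f x"
proof -
  have "[:- x (Suc k), 1:] * f = pCons 0 f - smult (x (Suc k)) f" by simp
  then show ?thesis by (simp only: div_diff_at_diff div_diff_at_smult div_diff_at_pCons) simp
qed

text \<open>
  Each linear factor cancels the last point and lowers the order by one, down to the value at
  \<open>x 0\<close> of a polynomial that vanishes there.  The points may coincide; the
  factors are then counted with multiplicity.
\<close>

lemma div_diff_at_eq_0:
  "(\<Prod>i\<le>k. [:- x i, 1:]) dvd f \<Longrightarrow> div_diff_at k f x = 0"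
proof (induction k arbitrary: f)
  case 0
  then have "poly f (x 0) = 0" by (simp add: poly_eq_0_iff_dvd)
  then show ?case by (simp add: div_diff_at_0)
next
  case (Suc k)
  then obtain g where g: "f = [:- x (Suc k), 1:] * ((\<Prod>i\<le>k. [:- x i, 1:]) * g)"
    by (auto simp: dvd_def mult_ac simp del: mult_pCons_left mult_pCons_right)
  have "div_diff_at k ((\<Prod>i\<le>k. [:- x i, 1:]) * g) x = 0"
    by (rule Suc.IH) simp
  then show ?case unfolding g div_diff_at_linear_mult .
qed

lemma div_diff_at_fract_poly:
  "div_diff_at k (map_poly to_fract g) (\<lambda>i. to_fract (x i)) \<in> range to_fract"
proof (induction g arbitrary: k)
  case 0
  show ?case by (metis div_diff_at_zero map_poly_0 rangeI to_fract_0)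
next
  case (pCons a g)
  then have IH: "\<exists>d. div_diff_at k (map_poly to_fract g) (\<lambda>i. to_fract (x i)) = to_fract d" for k
    by (auto simp: image_iff)
  obtain e where e: "\<And>k. div_diff_at k (map_poly to_fract g) (\<lambda>i. to_fract (x i)) = to_fract (e k)"
    using IH by metis
  have "map_poly to_fract (pCons a g) = pCons (to_fract a) (map_poly to_fract g)"
    by (simp add: map_poly_pCons)
  then have "div_diff_at k (map_poly to_fract (pCons a g)) (\<lambda>i. to_fract (x i)) =
      to_fract (x k * e k + (case k of 0 \<Rightarrow> a | Suc l \<Rightarrow> e l))"
    by (simp add: div_diff_at_pCons e split: nat.split)
  then show ?case by (simp only: rangeI)
qed

section \<open>The rings of integer-valued polynomials\<close>

lemma fract_poly_in_Int_div_diff: "map_poly to_fract g \<in> Int_div_diff n \<Omega>"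
  unfolding Int_div_diff_def using div_diff_at_fract_poly by blast

lemma const_in_Int_div_diff: "[:to_fract d:] \<in> Int_div_diff n \<Omega>"
  using fract_poly_in_Int_div_diff[of "[:d:]"] by (simp add: map_poly_pCons)

lemma zero_one_in_Int_div_diff:
  "0 \<in> to_fract ` Int_div_diff n \<Omega>" "1 \<in> to_fract ` Int_div_diff n \<Omega>"
  using fract_poly_in_Int_div_diff[of 0 n \<Omega>] fract_poly_in_Int_div_diff[of 1 n \<Omega>]
  by (auto simp: image_iff intro: bexI[of _ 0] bexI[of _ 1])

lemma Int_div_diff_diff:
  assumes "f \<in> Int_div_diff n \<Omega>" "g \<in> Int_div_diff n \<Omega>"
  shows "f - g \<in> Int_div_diff n \<Omega>"
  using assms unfolding Int_div_diff_def
  by (simp add: div_diff_at_diff image_iff) (metis to_fract_diff)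

lemma Int_div_diff_subset_Int_poly: "Int_div_diff n \<Omega> \<subseteq> Int_poly \<Omega>"
proof
  fix f assume f: "f \<in> Int_div_diff n \<Omega>"
  have "poly f (to_fract a) \<in> range to_fract" if "a \<in> \<Omega>" for a
    using f[unfolded Int_div_diff_def] that
    by (auto simp: div_diff_at_0 dest!: spec[of _ 0] spec[of _ "\<lambda>_. a"])
  then show "f \<in> Int_poly \<Omega>" by (simp add: Int_poly_def)
qed

lemma clear_denominators:
  fixes f :: "'a::idom fract poly"
  obtains d g where "d \<noteq> 0" "smult (to_fract d) f = map_poly to_fract g"
proof -
  have "\<exists>d g. d \<noteq> 0 \<and> smult (to_fract d) f = map_poly to_fract g"
  proof (induction f)
    case 0
    show ?case by (intro exI[of _ 1] exI[of _ 0]) simp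
  next
    case (pCons c f)
    then obtain d g where dg: "d \<noteq> 0" "smult (to_fract d) f = map_poly to_fract g" by blast
    obtain a b where ab: "b \<noteq> 0" "c = to_fract a / to_fract b" by (rule fract_eq_divide)
    have "smult (to_fract (b * d)) (pCons c f) =
        pCons (to_fract (d * a)) (smult (to_fract b) (smult (to_fract d) f))"
      using ab by simp
    also have "\<dots> = map_poly to_fract (pCons (d * a) (smult b g))"
      unfolding dg by (simp add: map_poly_pCons)
    finally show ?case using dg ab by (intro exI[of _ "b * d"]) (auto simp del: smult_pCons)
  qed
  then show ?thesis using that by blast
qed

lemma quotient_field_Int_div_diff:
  "quotient_field (to_fract ` Int_div_diff n \<Omega>) = UNIV"
proof -
  have "z \<in> quotient_field (to_fract ` Int_div_diff n \<Omega>)" for z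
  proof -
    obtain f g where fg: "g \<noteq> 0" "z = to_fract f / to_fract g" by (rule fract_eq_divide)
    obtain d f' where f': "d \<noteq> 0" "smult (to_fract d) f = map_poly to_fract f'"
      by (rule clear_denominators)
    obtain e g' where g': "e \<noteq> 0" "smult (to_fract e) g = map_poly to_fract g'"
      by (rule clear_denominators)
    let ?F = "map_poly to_fract (smult e f')" and ?G = "map_poly to_fract (smult d g')"
    have F: "?F = [:to_fract (d * e):] * f" and G: "?G = [:to_fract (d * e):] * g"
      by (simp_all add: mult_ac flip: f' g')
    have "z = to_fract ?F / to_fract ?G"
      unfolding F G to_fract_mult[where 'a = "'a fract poly"] using f' g' fg by simp
    moreover have "to_fract ?G \<noteq> 0"
      unfolding G using f' g' fg by simp
    ultimately show ?thesis
      unfolding quotient_field_def using fract_poly_in_Int_div_diff by blast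
  qed
  then show ?thesis by blast
qed

text \<open>
  After descent from \<open>K(X)\<close> to \<open>K[X]\<close>, evaluation at \<open>a \<in> \<Omega>\<close> carries an integral equation over
  the ring to one over \<open>D\<close>.
\<close>

lemma integral_over_Int_div_diff_imp:
  fixes \<Omega> :: "'a::idom set"
  assumes closed: "integrally_closed (range (to_fract :: 'a \<Rightarrow> 'a fract))"
    and z: "integral_over (to_fract ` Int_div_diff n \<Omega>) z"
  shows "z \<in> to_fract ` Int_poly \<Omega>"
proof -
  let ?R = "Int_div_diff n \<Omega>"
  have "z \<in> range to_fract"
    using z by (intro euclidean_ring_integrally_closed) (erule integral_over_mono, blast)
  then obtain f where f: "z = to_fract f" by blast
  obtain m c where c: "\<And>i. i < m \<Longrightarrow> c i \<in> to_fract ` ?R"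
    and rel: "z ^ m + (\<Sum>i<m. c i * z ^ i) = 0"
    using z by (auto simp: integral_over_iff zero_one_in_Int_div_diff)
  obtain g where g: "\<And>i. i < m \<Longrightarrow> g i \<in> ?R \<and> c i = to_fract (g i)"
    using c unfolding image_iff by metis
  have "to_fract (f ^ m + (\<Sum>i<m. g i * f ^ i)) = 0"
    using rel g by (simp add: f to_fract_power)
  then have rel': "f ^ m + (\<Sum>i<m. g i * f ^ i) = 0" by (simp only: to_fract_eq_0_iff)
  have "poly f (to_fract a) \<in> range to_fract" if a: "a \<in> \<Omega>" for a
  proof -
    let ?y = "poly f (to_fract a)"
    have "poly (f ^ m + (\<Sum>i<m. g i * f ^ i)) (to_fract a) = 0" unfolding rel' by simp
    then have eq: "?y ^ m + (\<Sum>i<m. poly (g i) (to_fract a) * ?y ^ i) = 0"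
      by (simp add: poly_sum)
    have "poly (g i) (to_fract a) \<in> range to_fract" if "i < m" for i
      using g[OF that] a Int_div_diff_subset_Int_poly[of n \<Omega>] by (auto simp: Int_poly_def)
    then have "integral_over (range to_fract) ?y"
      using eq zero_one_in_range_to_fract
      by (subst integral_over_iff) (auto intro!: exI[of _ m] exI[of _ "\<lambda>i. poly (g i) (to_fract a)"])
    moreover have "?y \<in> quotient_field (range to_fract)"
    proof -
      obtain u v where "v \<noteq> 0" "?y = to_fract u / to_fract v" by (rule fract_eq_divide)
      then show ?thesis unfolding quotient_field_def by fastforce
    qed
    ultimately show ?thesis
      using closed by (auto simp: integrally_closed_def integral_closure_def)
  qed
  then show ?thesis by (auto simp: f Int_poly_def)
qed

text \<open>
  The monic polynomial that witnesses integrality is \<open>q(T) - q(f)\<close>: only its constant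
  coefficient leaves \<open>D\<close>, and positive degree keeps that coefficient apart from the leading one.
\<close>

lemma integral_over_if_pcompose_mem:
  assumes q: "lead_coeff q = 1" "degree q > 0"
    and mem: "pcompose (map_poly to_fract q) f \<in> Int_div_diff n \<Omega>"
  shows "integral_over (to_fract ` Int_div_diff n \<Omega>) (to_fract f)"
proof -
  let ?R = "Int_div_diff n \<Omega>"
  let ?F = "pcompose (map_poly to_fract q) f"
  define m where "m = degree q"
  define c where "c i = [:to_fract (coeff q i):] - (if i = 0 then ?F else 0)" for i
  have c_mem: "c i \<in> ?R" for i
    unfolding c_def using mem const_in_Int_div_diff
    by (auto intro: Int_div_diff_diff simp del: diff_pCons)
  have "?F = (\<Sum>i\<le>m. [:to_fract (coeff q i):] * f ^ i)"
    by (simp add: pcompose_altdef poly_altdef degree_map_poly coeff_map_poly m_def)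
  then have F: "?F = f ^ m + (\<Sum>i<m. [:to_fract (coeff q i):] * f ^ i)"
    using q by (simp add: m_def flip: lessThan_Suc_atMost)
  have "(\<Sum>i<m. c i * f ^ i) =
      (\<Sum>i<m. [:to_fract (coeff q i):] * f ^ i - (if i = 0 then ?F else 0))"
    by (intro sum.cong) (auto simp: c_def algebra_simps)
  also have "\<dots> = (\<Sum>i<m. [:to_fract (coeff q i):] * f ^ i) - ?F"
    using q by (simp add: sum_subtractf m_def)
  finally have "f ^ m + (\<Sum>i<m. c i * f ^ i) = 0" using F by simp
  then have "to_fract (f ^ m + (\<Sum>i<m. c i * f ^ i)) = 0" by (simp only: to_fract_0)
  then have rel: "to_fract f ^ m + (\<Sum>i<m. to_fract (c i) * to_fract f ^ i) = 0"
    by (simp add: to_fract_power)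
  with c_mem show ?thesis
    using zero_one_in_Int_div_diff
    by (subst integral_over_iff) (auto intro!: exI[of _ m] exI[of _ "\<lambda>i. to_fract (c i)"])
qed

text \<open>
  Finiteness of \<open>\<Omega>\<close> allows one monic polynomial \<open>h\<close> to annihilate all values of \<open>f\<close>.  The
  power \<open>n + 1\<close> of \<open>h(f)\<close> is large enough to contain one linear factor for each of the
  \<open>k + 1 \<le> n + 1\<close> points of a divided difference, even if they are all equal.
\<close>

lemma Int_poly_integral_over_Int_div_diff:
  assumes "finite \<Omega>" and f: "f \<in> Int_poly \<Omega>"
  shows "integral_over (to_fract ` Int_div_diff n \<Omega>) (to_fract f)"
proof -
  obtain y where y: "\<And>a. a \<in> \<Omega> \<Longrightarrow> poly f (to_fract a) = to_fract (y a)"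
    using f unfolding Int_poly_def image_iff by (simp, metis)
  \<comment> \<open>The root \<open>0\<close> is added to make the degree of \<open>h\<close> positive when \<open>\<Omega>\<close> is empty.\<close>
  define h where "h = (\<Prod>d\<in>insert 0 (y ` \<Omega>). [:- d, 1:])"
  define H where "H = pcompose (map_poly to_fract h) f"
  have root: "[:- to_fract a, 1:] dvd H" if "a \<in> \<Omega>" for a
  proof -
    have "[:- y a, 1:] dvd h"
      unfolding h_def using that \<open>finite \<Omega>\<close> by (intro dvd_prodI) auto
    then obtain g where "h = [:- y a, 1:] * g" by blast
    then have "map_poly to_fract h = [:- to_fract (y a), 1:] * map_poly to_fract g"
      by (simp add: map_poly_pCons)
    then show ?thesis
      by (simp add: H_def poly_pcompose y[OF that] flip: poly_eq_0_iff_dvd)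
  qed
  have "H ^ Suc n \<in> Int_div_diff n \<Omega>"
    unfolding Int_div_diff_def
  proof (intro CollectI allI impI)
    fix k x assume k: "k \<le> n" and x: "\<forall>i\<le>k. x i \<in> \<Omega>"
    have "(\<Prod>i\<le>k. [:- to_fract (x i), 1:]) dvd (\<Prod>i\<le>k. H)"
      using x root by (intro prod_dvd_prod) auto
    also have "\<dots> dvd H ^ Suc n" using k by (simp add: le_imp_power_dvd del: power_Suc)
    finally have "div_diff_at k (H ^ Suc n) (\<lambda>i. to_fract (x i)) = 0" by (rule div_diff_at_eq_0)
    then show "div_diff_at k (H ^ Suc n) (\<lambda>i. to_fract (x i)) \<in> range to_fract"
      by (metis rangeI to_fract_0)
  qed
  moreover have "pcompose (map_poly to_fract (h ^ j)) f = H ^ j" for j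
    by (induction j) (simp_all add: H_def pcompose_mult pcompose_1)
  moreover have "lead_coeff (h ^ Suc n) = 1"
    unfolding lead_coeff_power by (simp add: h_def lead_coeff_prod)
  moreover have "degree (h ^ Suc n) > 0"
  proof -
    have "degree h = card (insert 0 (y ` \<Omega>))"
      unfolding h_def by (subst degree_prod_eq_sum_degree) auto
    then have "degree h > 0" using \<open>finite \<Omega>\<close> by (simp add: card_gt_0_iff)
    then show ?thesis by (subst degree_power_eq) auto
  qed
  ultimately show ?thesis
    by (intro integral_over_if_pcompose_mem[of "h ^ Suc n"]) (simp_all only:)
qed

theorem corollary3p4:
  fixes \<Omega> :: "'a::idom set" and n :: nat
  assumes "integrally_closed (range (to_fract :: 'a \<Rightarrow> 'a fract))"
    and "\<exists>a::'a. a \<noteq> 0 \<and> \<not> a dvd 1"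
    and "finite \<Omega>"
  shows "quotient_field (to_fract ` Int_div_diff n \<Omega>) = UNIV \<and>
         integral_closure (to_fract ` Int_div_diff n \<Omega>) = to_fract ` Int_poly \<Omega>"
proof
  show quot: "quotient_field (to_fract ` Int_div_diff n \<Omega>) = UNIV"
    by (rule quotient_field_Int_div_diff)
  show "integral_closure (to_fract ` Int_div_diff n \<Omega>) = to_fract ` Int_poly \<Omega>"
    unfolding integral_closure_def quot
    using integral_over_Int_div_diff_imp[OF assms(1)]
      Int_poly_integral_over_Int_div_diff[OF assms(3)]
    by auto
qed

end
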